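(* Let $\mathcal{H}$ be a Hilbert space with orthonormal basis $\{e_n\}_{n\ge0}$, let $H_0$ be the self-adjoint operator with $H_0e_n=ne_n$ for all $n\ge 0$, let $T$ be a bounded operator on $\mathcal{H}$ with bounded inverse, put $\varphi_n=Te_n$ and $\psi_n=(T^* )^{-1}e_n$, and let $\beta>0$. Let $$\omega_{\varphi\psi}(X)=\frac{1}{Z_0}\sum_{n\ge0}e^{-\beta n}\langle\varphi_n,X\psi_n\rangle,\qquad Z_0=\sum_{n\ge0}e^{-\beta n}.$$ Then for all $A,B\in B(\mathcal{H})$ $$\omega_{\varphi\psi}(BA)=\omega_{\varphi\psi}\big(A\,\alpha_\psi^{i\beta}(B)\big),$$ and both sides are equal to $\frac{1}{Z_0}\,\mathrm{tr}\big(e^{-\beta H^*}BA\big)$, where $e^{-\beta H^*}:=(T^* )^{-1}e^{-\beta H_0}T^*$.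
   Context: $B(\mathcal{H})$ is the algebra of bounded operators on $\mathcal{H}$, $\mathrm{tr}$ is its natural trace, and the inner product is linear in the second variable. For $t\in\mathbb{R}$ and $X\in B(\mathcal{H})$, $\alpha_0^t(X)=e^{iH_0t}Xe^{-iH_0t}$ and $\alpha_\psi^t(X)=(T^* )^{-1}\alpha_0^t\big(T^*X(T^* )^{-1}\big)T^*$. At the imaginary time $t=i\beta$ the same formulas are used, i.e. $\alpha_\psi^{i\beta}(B)=(T^* )^{-1}e^{-\beta H_0}T^*B(T^* )^{-1}e^{\beta H_0}T^*$, a possibly unbounded operator which is defined at least on the linear span of $\{\psi_n\}$. The functional $\omega_{\varphi\psi}$ is applied to any (possibly unbounded) operator $X$ whose domain contains all $\psi_n$ and for which the defining series converges absolutely; part of the claim is that this is so for $X=A\,\alpha_\psi^{i\beta}(B)$. *)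

theory Defs
  imports "HOL-Analysis.Analysis"
begin

section \<open>Complex Hilbert spaces\<close>

text \<open>The inner product is linear in the second variable. The norm is the one of
  \<^class>\<open>banach\<close>, so completeness is inherited from that class.\<close>

class complex_hilbert_space = banach +
  fixes scaleC :: "complex \<Rightarrow> 'a \<Rightarrow> 'a"  (infixr "*\<^sub>C" 75)
    and cinner :: "'a \<Rightarrow> 'a \<Rightarrow> complex"
  assumes scaleC_add_right: "a *\<^sub>C (x + y) = a *\<^sub>C x + a *\<^sub>C y"
    and scaleC_add_left: "(a + b) *\<^sub>C x = a *\<^sub>C x + b *\<^sub>C x"
    and scaleC_scaleC: "a *\<^sub>C b *\<^sub>C x = (a * b) *\<^sub>C x"
    and scaleC_one: "1 *\<^sub>C x = x"
    and scaleR_scaleC: "scaleR r x = complex_of_real r *\<^sub>C x"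
    and cinner_commute: "cinner x y = cnj (cinner y x)"
    and cinner_add_right: "cinner x (y + z) = cinner x y + cinner x z"
    and cinner_scaleC_right: "cinner x (a *\<^sub>C y) = a * cinner x y"
    and cinner_self: "cinner x x = complex_of_real ((norm x)\<^sup>2)"

global_interpretation complex_vector:
  vector_space "scaleC :: complex \<Rightarrow> 'a::complex_hilbert_space \<Rightarrow> 'a"
  defines cspan = complex_vector.span
  by unfold_locales
    (simp_all add: scaleC_add_right scaleC_add_left scaleC_scaleC scaleC_one)

definition is_onb :: "'a::complex_hilbert_space set \<Rightarrow> bool" where
  "is_onb F \<longleftrightarrow> (\<forall>f\<in>F. \<forall>g\<in>F. cinner f g = (if f = g then 1 else 0)) \<and>
     closure (cspan F) = UNIV"

section \<open>Bounded operators\<close>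

definition bounded_clinear :: "('a::complex_hilbert_space \<Rightarrow> 'a) \<Rightarrow> bool" where
  "bounded_clinear A \<longleftrightarrow> bounded_linear A \<and> (\<forall>c x. A (c *\<^sub>C x) = c *\<^sub>C A x)"

definition cadjoint :: "('a::complex_hilbert_space \<Rightarrow> 'a) \<Rightarrow> 'a \<Rightarrow> 'a" where
  "cadjoint A = (THE B. \<forall>x y. cinner (B x) y = cinner x (A y))"

section \<open>Possibly unbounded operators\<close>

text \<open>A possibly unbounded operator \<open>S\<close> is a partial map with domain \<open>dom S\<close>. Products are
  formed with \<open>\<circ>\<^sub>m\<close>, which gives them their natural domain.\<close>

type_synonym 'a operator = "'a \<rightharpoonup> 'a"

abbreviation (input) bop :: "('a \<Rightarrow> 'a) \<Rightarrow> 'a operator" where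
  "bop A \<equiv> \<lambda>x. Some (A x)"

definition linear_operator :: "'a::complex_hilbert_space operator \<Rightarrow> bool" where
  "linear_operator S \<longleftrightarrow>
     (\<forall>x\<in>dom S. \<forall>y\<in>dom S. S (x + y) = Some (the (S x) + the (S y))) \<and>
     (\<forall>c. \<forall>x\<in>dom S. S (c *\<^sub>C x) = Some (c *\<^sub>C the (S x)))"

text \<open>The Hilbert space adjoint; the vector \<open>z\<close> is unique because it is only used for densely
  defined \<open>S\<close>.\<close>

definition operator_adjoint :: "'a::complex_hilbert_space operator \<Rightarrow> 'a operator" where
  "operator_adjoint S y =
     (if \<exists>z. \<forall>x\<in>dom S. cinner z x = cinner y (the (S x))
      then Some (THE z. \<forall>x\<in>dom S. cinner z x = cinner y (the (S x)))
      else None)"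

definition self_adjoint :: "'a::complex_hilbert_space operator \<Rightarrow> bool" where
  "self_adjoint S \<longleftrightarrow>
     linear_operator S \<and> closure (dom S) = UNIV \<and> operator_adjoint S = S"

definition orth_proj :: "'a::complex_hilbert_space set \<Rightarrow> 'a \<Rightarrow> 'a" where
  "orth_proj M x = (THE p. p \<in> M \<and> (\<forall>v\<in>M. cinner v (x - p) = 0))"

definition eigenspace :: "'a::complex_hilbert_space operator \<Rightarrow> complex \<Rightarrow> 'a set" where
  "eigenspace H l = {v. H v = Some (l *\<^sub>C v)}"

text \<open>\<open>exp_operator z H\<close> is \<open>e\<^sup>z\<^sup>H\<close> in the spectral calculus of a self-adjoint \<open>H\<close> whose
  eigenvectors span a dense subspace: its spectral measure is then the sum of the projections
  \<open>P\<^sub>l\<close> onto the eigenspaces, \<open>e\<^sup>z\<^sup>H x\<close> is the sum of all \<open>e\<^sup>z\<^sup>l P\<^sub>l x\<close>, and the domain consists of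
  the \<open>x\<close> for which the squared norms of these terms have a finite sum. For an \<open>H\<close> with
  continuous spectrum the definition would be wrong.\<close>

definition exp_operator ::
    "complex \<Rightarrow> 'a::complex_hilbert_space operator \<Rightarrow> 'a operator" where
  "exp_operator z H x =
     (let term = (\<lambda>l::real. exp (z * of_real l) *\<^sub>C orth_proj (eigenspace H (of_real l)) x)
      in if (\<lambda>l. (norm (term l))\<^sup>2) summable_on UNIV then Some (\<Sum>\<^sub>\<infinity>l. term l) else None)"

section \<open>Trace\<close>

definition hilbert_schmidt :: "('a::complex_hilbert_space \<Rightarrow> 'a) \<Rightarrow> bool" where
  "hilbert_schmidt C \<longleftrightarrow> bounded_clinear C \<and>
     (\<exists>F. is_onb F \<and> (\<lambda>f. (norm (C f))\<^sup>2) summable_on F)"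

definition trace_class :: "'a::complex_hilbert_space operator \<Rightarrow> bool" where
  "trace_class X \<longleftrightarrow>
     (\<exists>C D. hilbert_schmidt C \<and> hilbert_schmidt D \<and> X = bop (C \<circ> D))"

text \<open>The common value of the diagonal sums over all orthonormal bases; meaningful for
  trace class \<open>X\<close>.\<close>

definition tr :: "'a::complex_hilbert_space operator \<Rightarrow> complex" where
  "tr X = (THE t. \<forall>F. is_onb F \<longrightarrow> ((\<lambda>f. cinner f (the (X f))) has_sum t) F)"

section \<open>Dynamics and Gibbs functional\<close>

text \<open>The time \<open>t\<close> is complex, so that \<open>t = \<i>\<beta>\<close> is allowed.\<close>

definition alpha0 ::
    "'a::complex_hilbert_space operator \<Rightarrow> complex \<Rightarrow> 'a operator \<Rightarrow> 'a operator" where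
  "alpha0 H t X = exp_operator (\<i> * t) H \<circ>\<^sub>m X \<circ>\<^sub>m exp_operator (- \<i> * t) H"

definition alpha_psi ::
    "'a::complex_hilbert_space operator \<Rightarrow> ('a \<Rightarrow> 'a) \<Rightarrow> complex \<Rightarrow> 'a operator \<Rightarrow> 'a operator"
  where
  "alpha_psi H T t X =
     bop (inv (cadjoint T)) \<circ>\<^sub>m
     alpha0 H t (bop (cadjoint T) \<circ>\<^sub>m X \<circ>\<^sub>m bop (inv (cadjoint T))) \<circ>\<^sub>m
     bop (cadjoint T)"

text \<open>\<open>e\<^sup>s\<^sup>H\<^sup>*\<close> for the non-self-adjoint Hamiltonian \<open>H\<^sup>* = (T\<^sup>*)\<^sup>-\<^sup>1 H\<^sub>0 T\<^sup>*\<close>.\<close>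

definition exp_Hstar ::
    "complex \<Rightarrow> 'a::complex_hilbert_space operator \<Rightarrow> ('a \<Rightarrow> 'a) \<Rightarrow> 'a operator" where
  "exp_Hstar s H0 T =
     bop (inv (cadjoint T)) \<circ>\<^sub>m exp_operator s H0 \<circ>\<^sub>m bop (cadjoint T)"

definition Z0 :: "real \<Rightarrow> real" where
  "Z0 \<beta> = (\<Sum>n. exp (- \<beta> * real n))"

definition omega_term ::
    "real \<Rightarrow> (nat \<Rightarrow> 'a::complex_hilbert_space) \<Rightarrow> (nat \<Rightarrow> 'a) \<Rightarrow> 'a operator \<Rightarrow> nat \<Rightarrow> complex"
  where
  "omega_term \<beta> \<phi> \<psi> X n =
     complex_of_real (exp (- \<beta> * real n)) * cinner (\<phi> n) (the (X (\<psi> n)))"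

definition omega_defined ::
    "real \<Rightarrow> (nat \<Rightarrow> 'a::complex_hilbert_space) \<Rightarrow> (nat \<Rightarrow> 'a) \<Rightarrow> 'a operator \<Rightarrow> bool" where
  "omega_defined \<beta> \<phi> \<psi> X \<longleftrightarrow>
     range \<psi> \<subseteq> dom X \<and> summable (\<lambda>n. norm (omega_term \<beta> \<phi> \<psi> X n))"

definition omega ::
    "real \<Rightarrow> (nat \<Rightarrow> 'a::complex_hilbert_space) \<Rightarrow> (nat \<Rightarrow> 'a) \<Rightarrow> 'a operator \<Rightarrow> complex" where
  "omega \<beta> \<phi> \<psi> X = 1 / complex_of_real (Z0 \<beta>) * (\<Sum>n. omega_term \<beta> \<phi> \<psi> X n)"

end

(*
Put K = exp(-beta H0), which is diagonal in e, let S be the adjoint of T and R its inverse. The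
terms of omega on B A are exp(-beta n) <e n, S B A R (e n)>. On the other side the factor
exp(beta n) coming from exp(beta H0) cancels the Gibbs weight, which leaves
<e n, A' K B' (e n)> with A' = S A R and B' = S B R. Both this sum and the trace of R K S B A over
an arbitrary orthonormal basis F are instances of
  sum over f in F of <f, M K N f> = sum over n of exp(-beta n) <e n, N M (e n)>.
Spectral input: self-adjointness of H0 forces its eigenspaces to be the lines through the e n.
*)

theory Submission
  imports Defs
begin

section \<open>Complex Hilbert spaces\<close>

lemma cinner_add_left: "cinner (x + y) z = cinner x z + cinner y (z :: 'a::complex_hilbert_space)"
  by (metis cinner_add_right cinner_commute complex_cnj_add)

lemma cinner_scaleC_left: "cinner (a *\<^sub>C x) y = cnj a * cinner x (y :: 'a::complex_hilbert_space)"
  by (metis cinner_commute cinner_scaleC_right complex_cnj_mult)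

lemma cinner_zero_right [simp]: "cinner x (0 :: 'a::complex_hilbert_space) = 0"
  by (metis add_cancel_right_right cinner_add_right)

lemma cinner_zero_left [simp]: "cinner (0 :: 'a::complex_hilbert_space) x = 0"
  by (metis add_cancel_right_right cinner_add_left)

lemma cinner_minus_right: "cinner x (- y) = - cinner x (y :: 'a::complex_hilbert_space)"
  by (metis add.right_inverse add_eq_0_iff cinner_add_right cinner_zero_right)

lemma cinner_diff_right: "cinner x (y - z) = cinner x y - cinner x (z :: 'a::complex_hilbert_space)"
  by (metis cinner_add_right cinner_minus_right diff_conv_add_uminus)

lemma cinner_diff_left: "cinner (x - y) z = cinner x z - cinner y (z :: 'a::complex_hilbert_space)"
  by (metis cinner_commute cinner_diff_right complex_cnj_diff)

lemma cinner_sum_right: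
  "cinner x (\<Sum>i\<in>S. f i) = (\<Sum>i\<in>S. cinner x (f i :: 'a::complex_hilbert_space))"
  by (induction S rule: infinite_finite_induct) (auto simp: cinner_add_right)

lemma cinner_eq_zero_commute:
  "cinner x y = 0 \<longleftrightarrow> cinner y (x :: 'a::complex_hilbert_space) = 0"
  by (metis cinner_commute complex_cnj_zero_iff)

text \<open>The class assumes homogeneity of the norm for real scalars only; the complex case is
  recovered from \<open>cinner_self\<close>.\<close>

lemma norm_scaleC: "norm (c *\<^sub>C x) = norm c * norm (x :: 'a::complex_hilbert_space)"
proof -
  have "complex_of_real ((norm (c *\<^sub>C x))\<^sup>2) = complex_of_real ((norm c * norm x)\<^sup>2)"
    unfolding cinner_self [symmetric] cinner_scaleC_left cinner_scaleC_right
    by (simp add: cinner_self power_mult_distrib complex_norm_square del: of_real_power)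
  then show ?thesis
    by (metis norm_ge_zero of_real_eq_iff power2_eq_imp_eq mult_nonneg_nonneg)
qed

lemma norm_add_orthogonal:
  assumes "cinner x (y :: 'a::complex_hilbert_space) = 0"
  shows "(norm (x + y))\<^sup>2 = (norm x)\<^sup>2 + (norm y)\<^sup>2"
proof -
  have "cinner (x + y) (x + y) = cinner x x + cinner y y"
    using assms cinner_eq_zero_commute [of x y]
    by (simp add: cinner_add_left cinner_add_right)
  then have "complex_of_real ((norm (x + y))\<^sup>2) = complex_of_real ((norm x)\<^sup>2 + (norm y)\<^sup>2)"
    by (simp add: cinner_self)
  then show ?thesis
    using of_real_eq_iff by blast
qed

text \<open>Cauchy-Schwarz, by Pythagoras for the splitting of \<open>y\<close> into its projection
  onto the line through \<open>x\<close> and the rest.\<close>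

lemma norm_cinner_le: "norm (cinner x y) \<le> norm x * norm (y :: 'a::complex_hilbert_space)"
proof (cases "x = 0")
  case False
  define c where "c = cinner x y / complex_of_real ((norm x)\<^sup>2)"
  have "cinner x (y - c *\<^sub>C x) = 0"
    using False by (simp add: cinner_diff_right cinner_scaleC_right cinner_self c_def)
  then have "cinner (c *\<^sub>C x) (y - c *\<^sub>C x) = 0"
    by (simp add: cinner_scaleC_left)
  then have "(norm y)\<^sup>2 = (norm (c *\<^sub>C x))\<^sup>2 + (norm (y - c *\<^sub>C x))\<^sup>2"
    using norm_add_orthogonal by fastforce
  then have "(norm c * norm x)\<^sup>2 \<le> (norm y)\<^sup>2"
    by (simp add: norm_scaleC)
  then have "norm c * norm x \<le> norm y"
    using power2_le_imp_le by fastforce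
  moreover have "norm c = norm (cinner x y) / (norm x)\<^sup>2"
    by (simp add: c_def norm_divide norm_power)
  ultimately show ?thesis
    using False by (simp add: field_simps power2_eq_square)
qed simp

lemma bounded_linear_cinner: "bounded_linear (cinner (x :: 'a::complex_hilbert_space))"
  by (rule bounded_linear_intro [where K = "norm x"])
    (simp_all add: cinner_add_right scaleR_scaleC cinner_scaleC_right scaleR_conv_of_real
      mult.commute [of "norm _" "norm x"] norm_cinner_le)

lemma bounded_clinear_imp_bounded_linear: "bounded_clinear A \<Longrightarrow> bounded_linear A"
  by (simp add: bounded_clinear_def)

lemma bounded_clinear_scaleC: "bounded_clinear A \<Longrightarrow> A (c *\<^sub>C x) = c *\<^sub>C A x"
  by (simp add: bounded_clinear_def)

lemma bounded_clinear_comp: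
  "bounded_clinear A \<Longrightarrow> bounded_clinear B \<Longrightarrow> bounded_clinear (A \<circ> B)"
  unfolding bounded_clinear_def using bounded_linear_compose by (auto simp: o_def)

lemma cinner_ext:
  assumes "\<And>z. cinner x z = cinner (y :: 'a::complex_hilbert_space) z"
  shows "x = y"
proof -
  have "cinner (x - y) (x - y) = 0"
    using assms by (simp add: cinner_diff_left)
  then show ?thesis
    by (simp add: cinner_self)
qed

lemma bounded_clinearI:
  assumes "\<And>x y. A (x + y) = A x + A (y :: 'a::complex_hilbert_space)"
    and "\<And>c x. A (c *\<^sub>C x) = c *\<^sub>C A x"
    and "\<And>x. norm (A x) \<le> norm x * K"
  shows "bounded_clinear A"
  unfolding bounded_clinear_def
  using assms by (auto intro: bounded_linear_intro [where K = K] simp: scaleR_scaleC)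

section \<open>Orthonormal bases\<close>

lemma is_onbD:
  "is_onb F \<Longrightarrow> f \<in> F \<Longrightarrow> g \<in> F \<Longrightarrow> cinner f g = (if f = g then 1 else 0)"
  by (simp add: is_onb_def)

text \<open>Best approximation: with \<open>p\<close> the projection of \<open>x\<close>, the
  residual \<open>x - p\<close> is orthogonal to all of \<open>cspan S\<close>, so Pythagoras
  applies to \<open>x - y = (x - p) + (p - y)\<close>.\<close>

lemma norm_diff_projection_le:
  assumes F: "is_onb F" and S: "finite S" "S \<subseteq> F" and y: "y \<in> cspan S"
  shows "norm (x - (\<Sum>f\<in>S. cinner f x *\<^sub>C f)) \<le> norm (x - y)"
proof -
  define p where "p = (\<Sum>f\<in>S. cinner f x *\<^sub>C f)"
  have p_in: "p \<in> cspan S"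
    unfolding p_def
    by (intro complex_vector.span_sum complex_vector.span_scale complex_vector.span_base)
  have orth: "cinner (x - p) f = 0" if "f \<in> S" for f
  proof -
    have "cinner f p = (\<Sum>g\<in>S. if g = f then cinner g x else 0)"
      unfolding p_def cinner_sum_right using that S F
      by (intro sum.cong) (auto simp: cinner_scaleC_right is_onbD subset_iff)
    also have "\<dots> = cinner f x"
      using that S by simp
    finally show ?thesis
      by (subst cinner_eq_zero_commute) (simp add: cinner_diff_right)
  qed
  have "cinner (x - p) v = 0" if "v \<in> cspan S" for v
    using that
    by (induction rule: complex_vector.span_induct_alt)
      (simp_all add: orth cinner_add_right cinner_scaleC_right)
  then have "cinner (x - p) (p - y) = 0"
    using p_in y complex_vector.span_diff by blast
  from norm_add_orthogonal [OF this] have "(norm (x - p))\<^sup>2 \<le> (norm (x - y))\<^sup>2"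
    by simp
  then show ?thesis
    unfolding p_def using power2_le_imp_le norm_ge_zero by blast
qed

text \<open>By density some \<open>y\<close> in the span of a finite \<open>S\<close> is close to
  \<open>x\<close>. It stays in the span of every larger finite subset of \<open>F\<close>, and the
  projection of \<open>x\<close> onto that span is at least as close.\<close>

lemma onb_expansion:
  assumes F: "is_onb (F :: 'a::complex_hilbert_space set)"
  shows "((\<lambda>f. cinner f x *\<^sub>C f) has_sum x) F"
  unfolding has_sum_def tendsto_iff
proof (intro allI impI)
  fix r :: real
  assume "r > 0"
  then obtain y where y: "y \<in> cspan F" "dist y x < r"
    using F closure_approachable [of x "cspan F"] by (auto simp: is_onb_def)
  then obtain S where S: "finite S" "S \<subseteq> F" "y \<in> cspan S"
    unfolding complex_vector.span_explicit by blast
  have "dist (\<Sum>f\<in>S'. cinner f x *\<^sub>C f) x < r" if "finite S'" "S \<subseteq> S'" "S' \<subseteq> F" for S'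
  proof -
    have "y \<in> cspan S'"
      using S(3) that(2) complex_vector.span_mono by blast
    from norm_diff_projection_le [OF F that(1,3) this, of x] y(2) show ?thesis
      unfolding dist_norm norm_minus_commute [of _ x] by linarith
  qed
  then show "\<forall>\<^sub>F S in finite_subsets_at_top F. dist (\<Sum>f\<in>S. cinner f x *\<^sub>C f) x < r"
    unfolding eventually_finite_subsets_at_top using S by blast
qed

lemma onb_parseval:
  assumes "is_onb F"
  shows "((\<lambda>f. cinner z f * cinner f x) has_sum cinner z x) F"
  using has_sum_bounded_linear [OF bounded_linear_cinner onb_expansion [OF assms], of z x]
  by (simp add: cinner_scaleC_right mult.commute)

lemma onb_norm_expansion:
  assumes "is_onb F"
  shows "((\<lambda>f. (norm (cinner f x))\<^sup>2) has_sum (norm x)\<^sup>2) F"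
proof -
  have "cinner x f * cinner f x = complex_of_real ((norm (cinner f x))\<^sup>2)" for f
    by (metis cinner_commute complex_norm_square mult.commute)
  then have "((\<lambda>f. complex_of_real ((norm (cinner f x))\<^sup>2)) has_sum complex_of_real ((norm x)\<^sup>2)) F"
    using onb_parseval [OF assms, of x x] by (simp add: cinner_self)
  then show ?thesis
    using has_sum_of_real_iff by blast
qed

text \<open>The estimate \<open>|ab| <= |a|^2 + |b|^2\<close> reduces both claims to
  \<open>onb_norm_expansion\<close>. The bound does not depend on \<open>F\<close>; it later
  controls the inner sums of a double series.\<close>

lemma onb_parseval_abs:
  assumes "is_onb F"
  shows "(\<lambda>f. norm (cinner z f * cinner f x)) summable_on F"
    and "(\<Sum>\<^sub>\<infinity>f\<in>F. norm (cinner z f * cinner f x)) \<le> (norm z)\<^sup>2 + (norm x)\<^sup>2"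
proof -
  have sum: "((\<lambda>f. (norm (cinner f z))\<^sup>2 + (norm (cinner f x))\<^sup>2) has_sum
      (norm z)\<^sup>2 + (norm x)\<^sup>2) F"
    by (intro has_sum_add onb_norm_expansion assms)
  have le: "norm (cinner z f * cinner f x) \<le> (norm (cinner f z))\<^sup>2 + (norm (cinner f x))\<^sup>2" for f
  proof -
    have norm_eq: "norm (cinner z f) = norm (cinner f z)"
      by (metis cinner_commute complex_mod_cnj)
    have "0 \<le> norm (cinner f z) * norm (cinner f x)"
      by simp
    then show ?thesis
      using sum_squares_bound [of "norm (cinner f z)" "norm (cinner f x)"]
      unfolding norm_mult norm_eq by linarith
  qed
  show summable: "(\<lambda>f. norm (cinner z f * cinner f x)) summable_on F"
    by (rule summable_on_comparison_test [OF has_sum_imp_summable [OF sum]]) (use le in auto)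
  show "(\<Sum>\<^sub>\<infinity>f\<in>F. norm (cinner z f * cinner f x)) \<le> (norm z)\<^sup>2 + (norm x)\<^sup>2"
    using has_sum_mono [OF has_sum_infsum [OF summable] sum] le by blast
qed

section \<open>Coordinates with respect to a fixed orthonormal sequence\<close>

locale onb_sequence =
  fixes e :: "nat \<Rightarrow> 'a::complex_hilbert_space"
  assumes inj_e: "inj e" and onb_e: "is_onb (range e)"
begin

lemma cinner_e: "cinner (e m) (e n) = (if m = n then 1 else 0)"
  using onb_e inj_e by (simp add: is_onbD inj_eq)

lemma norm_e [simp]: "norm (e n) = 1"
proof -
  have "complex_of_real ((norm (e n))\<^sup>2) = complex_of_real 1"
    unfolding cinner_self [symmetric] by (simp add: cinner_e)
  then have "(norm (e n))\<^sup>2 = 1\<^sup>2"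
    by (simp only: of_real_eq_iff power_one)
  then show ?thesis
    by (simp only: power2_eq_iff_nonneg norm_ge_zero zero_le_one)
qed

lemma has_sum_range_e: "(f has_sum s) (range e) \<longleftrightarrow> ((\<lambda>n. f (e n)) has_sum s) UNIV"
  using inj_e by (simp add: has_sum_reindex o_def)

lemma expansion: "((\<lambda>n. cinner (e n) x *\<^sub>C e n) has_sum x) UNIV"
  using onb_expansion [OF onb_e, of x] unfolding has_sum_range_e .

lemma eqI_coeff:
  assumes "\<And>n. cinner (e n) x = cinner (e n) y"
  shows "x = y"
  using expansion [of x] expansion [of y] assms has_sum_unique by fastforce

lemma cinner_lincomb_e:
  "finite S \<Longrightarrow> cinner (e n) (\<Sum>m\<in>S. a m *\<^sub>C e m) = (if n \<in> S then a n else 0)"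
  by (simp add: cinner_sum_right cinner_scaleC_right cinner_e if_distrib [of "(*) _"] cong: if_cong)

lemma norm_lincomb_e:
  assumes "finite S"
  shows "(norm (\<Sum>m\<in>S. a m *\<^sub>C e m))\<^sup>2 = (\<Sum>m\<in>S. (norm (a m))\<^sup>2)"
  using assms
proof (induction rule: finite_induct)
  case (insert k S)
  have "cinner (a k *\<^sub>C e k) (\<Sum>m\<in>S. a m *\<^sub>C e m) = 0"
    using insert by (simp add: cinner_scaleC_left cinner_lincomb_e)
  from norm_add_orthogonal [OF this] show ?case
    using insert by (simp add: norm_scaleC)
qed simp

text \<open>A finite block of the vector series has squared norm equal to the same block of the
  scalar series, so the Cauchy criterion carries over and completeness gives the limit.\<close>

lemma riesz_fischer:
  assumes "summable (\<lambda>n. (norm (a n))\<^sup>2)"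
  shows "summable (\<lambda>n. a n *\<^sub>C e n)"
  unfolding summable_Cauchy
proof (intro allI impI)
  fix r :: real
  assume r: "r > 0"
  then obtain N where N: "norm (\<Sum>k=m..<n. (norm (a k))\<^sup>2) < r\<^sup>2" if "m \<ge> N" for m n
    using assms unfolding summable_Cauchy by (meson zero_less_power)
  have "norm (\<Sum>k=m..<n. a k *\<^sub>C e k) < r" if "m \<ge> N" for m n
  proof -
    have "(norm (\<Sum>k=m..<n. a k *\<^sub>C e k))\<^sup>2 < r\<^sup>2"
      using N [OF that, of n] by (simp add: norm_lincomb_e)
    then show ?thesis
      using r power2_less_imp_less by fastforce
  qed
  then show "\<exists>N. \<forall>m\<ge>N. \<forall>n. norm (\<Sum>k=m..<n. a k *\<^sub>C e k) < r"
    by blast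
qed

section \<open>Adjoints\<close>

text \<open>Riesz representation of the bounded functional that sends \<open>y\<close> to
  \<open>cinner x (A y)\<close>; the vector is built from its coefficients in
  \<open>e\<close>.\<close>

lemma riesz_representation_adjoint:
  fixes A :: "'a \<Rightarrow> 'a"
  assumes A: "bounded_clinear A"
  shows "\<exists>z. \<forall>y. cinner z y = cinner x (A y)"
proof -
  from bounded_clinear_imp_bounded_linear [OF A] interpret A: bounded_linear A .
  obtain K where K: "\<And>y. norm (A y) \<le> norm y * K" "K > 0"
    using A.pos_bounded by blast
  \<comment> \<open>This is the value that \<open>cinner (e n) z\<close> is forced to have.\<close>
  define a where "a n = cinner (A (e n)) x" for n
  have "(\<Sum>n<N. (norm (a n))\<^sup>2) \<le> (K * norm x)\<^sup>2" for N
  proof -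
    define s where "s = (\<Sum>n<N. a n *\<^sub>C e n)"
    have s2: "(norm s)\<^sup>2 = (\<Sum>n<N. (norm (a n))\<^sup>2)"
      by (simp add: s_def norm_lincomb_e)
    \<comment> \<open>Tested on the partial sum \<open>s\<close> itself, the functional returns the
      squared norm of \<open>s\<close>; its boundedness then bounds \<open>norm s\<close> uniformly
      in \<open>N\<close>.\<close>
    have "A s = (\<Sum>n<N. a n *\<^sub>C A (e n))"
      unfolding s_def A.sum bounded_clinear_scaleC [OF A] ..
    then have "cinner x (A s) = (\<Sum>n<N. a n * cnj (a n))"
      by (simp add: cinner_sum_right cinner_scaleC_right a_def flip: cinner_commute)
    also have "\<dots> = complex_of_real ((norm s)\<^sup>2)"
      unfolding s2 of_real_sum complex_norm_square ..
    finally have "(norm s)\<^sup>2 = norm (cinner x (A s))"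
      by (simp add: norm_power)
    also have "\<dots> \<le> norm x * (norm s * K)"
      using norm_cinner_le K(1) by (meson mult_left_mono norm_ge_zero order_trans)
    finally have "norm s * norm s \<le> norm s * (K * norm x)"
      by (simp add: power2_eq_square mult_ac)
    then have "norm s \<le> K * norm x"
      using K(2) by (cases "norm s = 0") (auto simp: mult_le_cancel_left)
    then show ?thesis
      using s2 power_mono norm_ge_zero by metis
  qed
  then have "summable (\<lambda>n. (norm (a n))\<^sup>2)"
    by (intro summableI_nonneg_bounded [where x = "(K * norm x)\<^sup>2"]) auto
  then obtain z where z: "(\<lambda>n. a n *\<^sub>C e n) sums z"
    using riesz_fischer by (auto simp: summable_def)
  have ze: "cinner z (e n) = cinner x (A (e n))" for n
  proof -
    have "(\<lambda>m. cinner (e n) (a m *\<^sub>C e m)) sums cinner (e n) z"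
      using bounded_linear.sums [OF bounded_linear_cinner z] .
    moreover have "(\<lambda>m. cinner (e n) (a m *\<^sub>C e m)) = (\<lambda>m. if m = n then a m else 0)"
      by (auto simp: cinner_scaleC_right cinner_e)
    ultimately have "cinner (e n) z = a n"
      using sums_single [of n a] sums_unique2 by metis
    then show ?thesis
      by (metis a_def cinner_commute)
  qed
  \<comment> \<open>Both sides are bounded and linear in \<open>y\<close> and agree on the basis, so
    they agree on the expansion of \<open>y\<close>.\<close>
  have "cinner z y = cinner x (A y)" for y
  proof -
    have bl: "bounded_linear (\<lambda>y. cinner x (A y))"
      by (rule bounded_linear_compose [OF bounded_linear_cinner A.bounded_linear])
    show ?thesis
      using has_sum_bounded_linear [OF bounded_linear_cinner expansion, of z y]
        has_sum_bounded_linear [OF bl expansion, of y]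
      by (simp add: cinner_scaleC_right bounded_clinear_scaleC [OF A] ze has_sum_unique)
  qed
  then show ?thesis
    by blast
qed

text \<open>\<open>cadjoint\<close> is a definite description. Riesz vectors chosen for each
  \<open>x\<close> give existence, and \<open>cinner_ext\<close> gives uniqueness.\<close>

lemma cinner_cadjoint:
  fixes A :: "'a \<Rightarrow> 'a"
  assumes A: "bounded_clinear A"
  shows "cinner (cadjoint A x) y = cinner x (A y)"
proof -
  obtain C where C: "\<forall>x y. cinner (C x) y = cinner x (A y)"
    using riesz_representation_adjoint [OF A] by metis
  have "\<forall>x y. cinner (cadjoint A x) y = cinner x (A y)"
    unfolding cadjoint_def
  proof (rule theI [where a = C])
    show "C' = C" if "\<forall>x y. cinner (C' x) y = cinner x (A y)" for C'
      using C that by (intro ext cinner_ext) simp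
  qed (rule C)
  then show ?thesis
    by blast
qed

lemma cinner_cadjoint_right:
  fixes A :: "'a \<Rightarrow> 'a"
  shows "bounded_clinear A \<Longrightarrow> cinner x (cadjoint A y) = cinner (A x) y"
  by (metis cinner_cadjoint cinner_commute)

text \<open>The norm bound comes from writing the squared norm of \<open>cadjoint A x\<close> as
  \<open>cinner x (A (cadjoint A x))\<close> and cancelling one factor.\<close>

lemma bounded_clinear_cadjoint:
  fixes A :: "'a \<Rightarrow> 'a"
  assumes A: "bounded_clinear A"
  shows "bounded_clinear (cadjoint A)"
proof -
  obtain K where K: "\<And>y. norm (A y) \<le> norm y * K" "K > 0"
    using bounded_linear.pos_bounded [OF bounded_clinear_imp_bounded_linear [OF A]] by blast
  show ?thesis
  proof (rule bounded_clinearI [where K = K])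
    show "cadjoint A (x + y) = cadjoint A x + cadjoint A y" for x y
      by (rule cinner_ext) (simp add: cinner_cadjoint [OF A] cinner_add_left)
    show "cadjoint A (c *\<^sub>C x) = c *\<^sub>C cadjoint A x" for c x
      by (rule cinner_ext) (simp add: cinner_cadjoint [OF A] cinner_scaleC_left)
    show "norm (cadjoint A x) \<le> norm x * K" for x
    proof -
      have "(norm (cadjoint A x))\<^sup>2 = norm (cinner x (A (cadjoint A x)))"
        by (simp add: norm_power cinner_self flip: cinner_cadjoint [OF A])
      also have "\<dots> \<le> norm x * (norm (cadjoint A x) * K)"
        using norm_cinner_le K(1) by (meson mult_left_mono norm_ge_zero order_trans)
      finally have "norm (cadjoint A x) * norm (cadjoint A x) \<le> norm (cadjoint A x) * (norm x * K)"
        by (simp add: power2_eq_square mult_ac)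
      then show ?thesis
        using K(2) by (cases "norm (cadjoint A x) = 0") (auto simp: mult_le_cancel_left)
    qed
  qed
qed

text \<open>Adjoints reverse products, so the adjoint of \<open>inv T\<close> is a two-sided inverse
  of \<open>cadjoint T\<close>; hence that inverse is bounded too.\<close>

lemma inv_cadjoint:
  fixes T :: "'a \<Rightarrow> 'a"
  assumes T: "bounded_clinear T" "bij T" "bounded_clinear (inv T)"
  shows "bij (cadjoint T)" and "inv (cadjoint T) = cadjoint (inv T)"
proof -
  have 1: "cadjoint T (cadjoint (inv T) x) = x" for x
    by (rule cinner_ext) (simp add: cinner_cadjoint T bij_is_inj)
  have 2: "cadjoint (inv T) (cadjoint T x) = x" for x
    by (rule cinner_ext) (simp add: cinner_cadjoint T bij_is_surj surj_f_inv_f)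
  show "bij (cadjoint T)"
    using 1 2 by (metis bijI')
  show "inv (cadjoint T) = cadjoint (inv T)"
    using 1 2 by (intro inv_equality)
qed

end

section \<open>The number operator\<close>

lemma summable_exp_neg:
  fixes b :: real
  assumes "b > 0"
  shows "summable (\<lambda>n. exp (- b * real n))"
proof -
  have "(\<lambda>n. exp (- b * real n)) = (\<lambda>n. exp (- b) ^ n)"
    by (simp add: exp_of_nat_mult [symmetric] mult.commute)
  then show ?thesis
    using assms by (simp add: summable_geometric)
qed

section \<open>Eigenspaces of \<open>H0\<close> and its exponentials\<close>

locale number_operator = onb_sequence e for e :: "nat \<Rightarrow> 'a::complex_hilbert_space" +
  fixes H0 :: "'a operator"
  assumes self_adjoint_H0: "self_adjoint H0"
    and H0_e: "\<And>n. H0 (e n) = Some (of_nat n *\<^sub>C e n)"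
begin

text \<open>Self-adjointness enters here: \<open>H0\<close> is its own adjoint, so it can be moved
  onto \<open>e n\<close>. This fixes \<open>H0\<close> on its whole domain, not only on the
  basis.\<close>

lemma cinner_e_H0:
  assumes "H0 v = Some w"
  shows "cinner (e n) w = of_nat n * cinner (e n) v"
proof -
  define P where "P z \<longleftrightarrow> (\<forall>x\<in>dom H0. cinner z x = cinner v (the (H0 x)))" for z
  have dom_e: "e k \<in> dom H0" for k
    using H0_e by blast
  have "operator_adjoint H0 v = Some w"
    using self_adjoint_H0 assms by (simp add: self_adjoint_def)
  then have ex: "\<exists>z. P z" and w: "w = (THE z. P z)"
    by (auto simp: operator_adjoint_def P_def split: if_splits)
  \<comment> \<open>The description in \<open>operator_adjoint\<close> is unambiguous because the
    domain contains every \<open>e k\<close>.\<close>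
  have "z = z'" if "P z" "P z'" for z z'
  proof (rule eqI_coeff)
    fix k
    have "cinner z (e k) = cinner z' (e k)"
      using that dom_e by (simp add: P_def)
    then show "cinner (e k) z = cinner (e k) z'"
      by (metis cinner_commute)
  qed
  then have "P w"
    using ex w theI [of P] by blast
  then have "cinner w (e n) = of_nat n * cinner v (e n)"
    using dom_e H0_e by (simp add: P_def cinner_scaleC_right)
  then show ?thesis
    by (metis cinner_commute complex_cnj_mult complex_cnj_of_nat)
qed

lemma cinner_e_eigenvector:
  assumes "v \<in> eigenspace H0 l" and "l \<noteq> of_nat n"
  shows "cinner (e n) v = 0"
  using cinner_e_H0 [of v "l *\<^sub>C v" n] assms by (simp add: eigenspace_def cinner_scaleC_right)

lemma scaleC_e_in_eigenspace: "c *\<^sub>C e n \<in> eigenspace H0 (of_nat n)"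
proof -
  have "e n \<in> dom H0"
    using H0_e by blast
  then have "H0 (c *\<^sub>C e n) = Some (c *\<^sub>C (of_nat n *\<^sub>C e n))"
    using self_adjoint_H0 H0_e [of n] unfolding self_adjoint_def linear_operator_def
    by (metis option.sel)
  then show ?thesis
    by (simp add: eigenspace_def scaleC_scaleC mult.commute)
qed

text \<open>The eigenvalues are simple: an eigenvector for \<open>n\<close> has zero coefficient at
  every other basis vector.\<close>

lemma eigenspace_of_nat: "eigenspace H0 (of_nat n) = range (\<lambda>c. c *\<^sub>C e n)"
proof
  show "eigenspace H0 (of_nat n) \<subseteq> range (\<lambda>c. c *\<^sub>C e n)"
  proof
    fix v
    assume v: "v \<in> eigenspace H0 (of_nat n)"
    have "v = cinner (e n) v *\<^sub>C e n"
      using cinner_e_eigenvector [OF v]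
      by (intro eqI_coeff) (auto simp: cinner_scaleC_right cinner_e)
    then show "v \<in> range (\<lambda>c. c *\<^sub>C e n)"
      by blast
  qed
qed (use scaleC_e_in_eigenspace in auto)

lemma eigenspace_trivial:
  assumes "\<And>n. l \<noteq> of_nat n"
  shows "eigenspace H0 l = {0}"
proof -
  have "v = 0" if "v \<in> eigenspace H0 l" for v
    using cinner_e_eigenvector [OF that assms] by (intro eqI_coeff) simp
  \<comment> \<open>\<open>H0\<close> is partial, so \<open>0\<close> must be shown to lie in its
    domain: it is the multiple \<open>0\<close> of \<open>e 0\<close>.\<close>
  moreover have "0 \<in> eigenspace H0 l"
    using scaleC_e_in_eigenspace [of 0 0] by (simp add: eigenspace_def)
  ultimately show ?thesis
    by blast
qed

lemma orth_proj_eigenspace_of_nat: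
  "orth_proj (eigenspace H0 (of_nat n)) x = cinner (e n) x *\<^sub>C e n"
  unfolding orth_proj_def eigenspace_of_nat
proof (rule the_equality)
  fix p
  assume p: "p \<in> range (\<lambda>c. c *\<^sub>C e n) \<and> (\<forall>v\<in>range (\<lambda>c. c *\<^sub>C e n). cinner v (x - p) = 0)"
  then obtain c where c: "p = c *\<^sub>C e n"
    by blast
  have "cinner (1 *\<^sub>C e n) (x - p) = 0"
    using p by blast
  then show "p = cinner (e n) x *\<^sub>C e n"
    by (simp add: c cinner_diff_right cinner_scaleC_right cinner_e)
qed (auto simp: cinner_scaleC_left cinner_diff_right cinner_scaleC_right cinner_e)

lemma orth_proj_eigenspace_trivial:
  assumes "\<And>n. l \<noteq> of_nat n"
  shows "orth_proj (eigenspace H0 l) x = 0"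
  unfolding orth_proj_def eigenspace_trivial [OF assms] by (rule the_equality) auto

text \<open>The sum over all real \<open>l\<close> in \<open>exp_operator\<close> collapses to the
  naturals, since the projections vanish elsewhere. The domain condition becomes square summability
  of the weighted coefficients.\<close>

lemma exp_operator_eqI:
  assumes sq: "summable (\<lambda>n. (norm (exp (z * of_nat n) * cinner (e n) x))\<^sup>2)"
    and y: "((\<lambda>n. (exp (z * of_nat n) * cinner (e n) x) *\<^sub>C e n) has_sum y) UNIV"
  shows "exp_operator z H0 x = Some y"
proof -
  define u where
    "u l = exp (z * of_real l) *\<^sub>C orth_proj (eigenspace H0 (of_real l)) x" for l :: real
  have u_nat: "u (real n) = (exp (z * of_nat n) * cinner (e n) x) *\<^sub>C e n" for n
    by (simp add: u_def orth_proj_eigenspace_of_nat scaleC_scaleC)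
  have u_0: "u l = 0" if "l \<notin> range real" for l
  proof -
    have "complex_of_real l \<noteq> of_nat n" for n
      using that by (metis of_real_eq_iff of_real_of_nat_eq rangeI)
    then show ?thesis
      by (simp add: u_def orth_proj_eigenspace_trivial)
  qed
  \<comment> \<open>The codomain is left general because the transfer serves both the vector sum and
    the sum of squared norms.\<close>
  have to_nat: "(g has_sum s) UNIV \<longleftrightarrow> ((\<lambda>n. g (real n)) has_sum s) UNIV"
    if "\<And>l. l \<notin> range real \<Longrightarrow> g l = 0"
    for g :: "real \<Rightarrow> 'b::{comm_monoid_add, topological_space}" and s
  proof -
    have "(g has_sum s) UNIV \<longleftrightarrow> (g has_sum s) (range real)"
      using that by (intro has_sum_cong_neutral) auto
    then show ?thesis
      by (simp add: has_sum_reindex inj_on_def o_def)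
  qed
  have "(u has_sum y) UNIV"
    using y by (subst to_nat) (auto simp: u_0 u_nat)
  moreover have "(\<lambda>l. (norm (u l))\<^sup>2) summable_on UNIV"
  proof -
    have "(\<lambda>n. (norm (u (real n)))\<^sup>2) summable_on UNIV"
      using sq by (simp add: summable_on_UNIV_nonneg_real_iff u_nat norm_scaleC)
    then show ?thesis
      unfolding summable_on_def by (subst to_nat) (auto simp: u_0)
  qed
  ultimately show ?thesis
    by (simp add: exp_operator_def Let_def infsumI flip: u_def)
qed

text \<open>\<open>z\<close> is arbitrary, so the basis lies in the domain of the unbounded
  exponentials as well: only one coefficient is non-zero.\<close>

lemma exp_operator_e: "exp_operator z H0 (e n) = Some (exp (z * of_nat n) *\<^sub>C e n)"
proof (rule exp_operator_eqI)
  show "summable (\<lambda>m. (norm (exp (z * of_nat m) * cinner (e m) (e n)))\<^sup>2)"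
    by (rule summable_finite [of "{n}"]) (auto simp: cinner_e)
  show "((\<lambda>m. (exp (z * of_nat m) * cinner (e m) (e n)) *\<^sub>C e m) has_sum
      exp (z * of_nat n) *\<^sub>C e n) UNIV"
    by (rule has_sum_finite_neutralI [of "{n}"]) (auto simp: cinner_e)
qed

section \<open>The bounded operator \<open>exp(-b H0)\<close> and its traces\<close>

definition gibbs :: "real \<Rightarrow> 'a \<Rightarrow> 'a" where
  "gibbs b x = (\<Sum>\<^sub>\<infinity>n. (exp (- of_real b * of_nat n) * cinner (e n) x) *\<^sub>C e n)"

context
  fixes b :: real
  assumes b: "b > 0"
begin

lemma norm_gibbs_term:
  "norm ((exp (- of_real b * of_nat n) * cinner (e n) x) *\<^sub>C e n) \<le> exp (- b * real n) * norm x"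
  using norm_cinner_le [of "e n" x] by (simp add: norm_scaleC norm_mult norm_exp_eq_Re)

lemma summable_norm_gibbs_term:
  "summable (\<lambda>n. norm ((exp (- of_real b * of_nat n) * cinner (e n) x) *\<^sub>C e n))"
  by (rule summable_comparison_test' [OF summable_mult2 [OF summable_exp_neg [OF b]]])
    (use norm_gibbs_term in auto)

lemma gibbs_has_sum:
  "((\<lambda>n. (exp (- of_real b * of_nat n) * cinner (e n) x) *\<^sub>C e n) has_sum gibbs b x) UNIV"
  unfolding gibbs_def
  by (intro has_sum_infsum norm_summable_imp_summable_on summable_norm_gibbs_term)

text \<open>The weights are at most 1, so square summability of the coefficients of \<open>x\<close>
  gives the domain condition for every \<open>x\<close>.\<close>

lemma exp_operator_gibbs: "exp_operator (- of_real b) H0 x = Some (gibbs b x)"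
proof (rule exp_operator_eqI [OF _ gibbs_has_sum])
  show "summable (\<lambda>n. (norm (exp (- of_real b * of_nat n) * cinner (e n) x))\<^sup>2)"
  proof (rule summable_comparison_test')
    show "summable (\<lambda>n. (norm (cinner (e n) x))\<^sup>2)"
      using onb_norm_expansion [OF onb_e, of x] has_sum_imp_sums sums_summable
      unfolding has_sum_range_e by blast
    have "norm (exp (- of_real b * of_nat n) * cinner (e n) x) \<le> norm (cinner (e n) x)" for n
      using b by (simp add: norm_mult norm_exp_eq_Re mult_left_le_one_le)
    then show "norm ((norm (exp (- of_real b * of_nat n) * cinner (e n) x))\<^sup>2)
        \<le> (norm (cinner (e n) x))\<^sup>2" if "n \<ge> 0" for n
      by (simp add: power_mono)
  qed
qed

lemma cinner_e_gibbs: "cinner (e n) (gibbs b x) = exp (- of_real b * of_nat n) * cinner (e n) x"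
proof -
  have "((\<lambda>m. cinner (e n) ((exp (- of_real b * of_nat m) * cinner (e m) x) *\<^sub>C e m)) has_sum
      cinner (e n) (gibbs b x)) UNIV"
    by (rule has_sum_bounded_linear [OF bounded_linear_cinner gibbs_has_sum])
  moreover have "((\<lambda>m. cinner (e n) ((exp (- of_real b * of_nat m) * cinner (e m) x) *\<^sub>C e m)) has_sum
      exp (- of_real b * of_nat n) * cinner (e n) x) UNIV"
    by (rule has_sum_finite_neutralI [of "{n}"]) (auto simp: cinner_scaleC_right cinner_e)
  ultimately show ?thesis
    using has_sum_unique by blast
qed

lemma gibbs_e: "gibbs b (e n) = exp (- of_real b * of_nat n) *\<^sub>C e n"
  by (rule eqI_coeff) (simp add: cinner_e_gibbs cinner_scaleC_right cinner_e)

lemma bounded_clinear_gibbs: "bounded_clinear (gibbs b)"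
proof (rule bounded_clinearI)
  show "gibbs b (x + y) = gibbs b x + gibbs b y" for x y
    by (rule eqI_coeff) (simp add: cinner_e_gibbs cinner_add_right distrib_left)
  show "gibbs b (c *\<^sub>C x) = c *\<^sub>C gibbs b x" for c x
    by (rule eqI_coeff) (simp add: cinner_e_gibbs cinner_scaleC_right)
  show "norm (gibbs b x) \<le> norm x * (\<Sum>n. exp (- b * real n))" for x
  proof -
    let ?t = "\<lambda>n. (exp (- of_real b * of_nat n) * cinner (e n) x) *\<^sub>C e n"
    have "gibbs b x = (\<Sum>n. ?t n)"
      using gibbs_has_sum has_sum_imp_sums sums_unique by blast
    also have "norm \<dots> \<le> (\<Sum>n. exp (- b * real n) * norm x)"
      using norm_gibbs_term summable_mult2 [OF summable_exp_neg [OF b]]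
      by (rule norm_suminf_le)
    also have "\<dots> = norm x * (\<Sum>n. exp (- b * real n))"
      by (subst suminf_mult2 [OF summable_exp_neg [OF b], symmetric]) (rule mult.commute)
    finally show ?thesis .
  qed
qed

text \<open>A diagonal operator with real weights is its own adjoint; this is checked on
  coefficients.\<close>

lemma cinner_gibbs_commute: "cinner (gibbs b x) y = cinner x (gibbs b y)"
proof -
  have "cadjoint (gibbs b) x = gibbs b x"
    by (rule eqI_coeff)
      (simp add: cinner_cadjoint_right bounded_clinear_gibbs gibbs_e cinner_scaleC_left cinner_e_gibbs
        exp_cnj)
  then show ?thesis
    by (metis cinner_cadjoint bounded_clinear_gibbs)
qed

lemma summable_gibbs_diagonal:
  fixes R :: "'a \<Rightarrow> 'a"
  assumes "bounded_clinear R"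
  shows "summable (\<lambda>n. norm (exp (- of_real b * of_nat n) * cinner (e n) (R (e n))))"
proof -
  obtain K where K: "\<And>y. norm (R y) \<le> norm y * K"
    using bounded_linear.bounded [OF bounded_clinear_imp_bounded_linear [OF assms]] by blast
  have "norm (cinner (e n) (R (e n))) \<le> K" for n
    using norm_cinner_le [of "e n" "R (e n)"] K [of "e n"] by simp
  then show ?thesis
    by (intro summable_comparison_test' [OF summable_mult2 [OF summable_exp_neg [OF b], of K]])
      (auto simp: norm_mult norm_exp_eq_Re)
qed

text \<open>Cyclicity of the trace: the double family
  \<open>e\<^sup>-\<^sup>b\<^sup>m \<langle>N\<^sup>* e\<^sub>m, f\<rangle> \<langle>f, M e\<^sub>m\<rangle>\<close> is absolutely summable, and the two orders of summation give
  the two diagonal sums, by Parseval in \<open>F\<close> and by the definition of \<^const>\<open>gibbs\<close>.\<close>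

lemma gibbs_trace_cyclic:
  fixes M N :: "'a \<Rightarrow> 'a"
  assumes M: "bounded_clinear M" and N: "bounded_clinear N" and F: "is_onb F"
  shows "((\<lambda>f. cinner f (M (gibbs b (N f)))) has_sum
    (\<Sum>n. exp (- of_real b * of_nat n) * cinner (e n) (N (M (e n))))) F"
proof -
  define w where "w n = exp (- complex_of_real b * of_nat n)" for n
  define g where "g m f = w m * (cinner (cadjoint N (e m)) f * cinner f (M (e m)))" for m f
  note N' = bounded_clinear_cadjoint [OF N]
  obtain K L where K: "\<And>y. norm (M y) \<le> norm y * K" and L: "\<And>y. norm (cadjoint N y) \<le> norm y * L"
    using bounded_linear.bounded [OF bounded_clinear_imp_bounded_linear] M N' by metis
  have norm_w: "norm (w n) = exp (- b * real n)" for n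
    by (simp add: w_def norm_exp_eq_Re)
  have "(\<lambda>p. norm (case p of (m, f) \<Rightarrow> g m f)) summable_on UNIV \<times> F"
    unfolding Infinite_Sum.abs_summable_on_Sigma_iff
  proof (intro conjI ballI)
    show "(\<lambda>f. norm (case (m, f) of (m, f) \<Rightarrow> g m f)) summable_on F" for m
      unfolding g_def norm_mult [of "w m"] prod.case
      by (intro summable_on_cmult_right onb_parseval_abs F)
    \<comment> \<open>The Parseval bound on the unweighted inner sums is uniform in
      \<open>m\<close>, so the factor \<open>exp (- b * real m)\<close> makes the outer sum
      converge.\<close>
    have "(\<Sum>\<^sub>\<infinity>f\<in>F. norm (g m f)) \<le> exp (- b * real m) * (L\<^sup>2 + K\<^sup>2)" for m
    proof -
      have "norm (cadjoint N (e m)) \<le> L" "norm (M (e m)) \<le> K"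
        using K [of "e m"] L [of "e m"] by simp_all
      then have "(norm (cadjoint N (e m)))\<^sup>2 + (norm (M (e m)))\<^sup>2 \<le> L\<^sup>2 + K\<^sup>2"
        by (intro add_mono power_mono) auto
      then have "(\<Sum>\<^sub>\<infinity>f\<in>F. norm (cinner (cadjoint N (e m)) f * cinner f (M (e m)))) \<le> L\<^sup>2 + K\<^sup>2"
        using onb_parseval_abs(2) [OF F] order_trans by blast
      then show ?thesis
        unfolding g_def norm_mult [of "w m"] norm_w
        by (subst infsum_cmult_right) (auto intro: onb_parseval_abs F)
    qed
    moreover have "(\<lambda>m. exp (- b * real m) * (L\<^sup>2 + K\<^sup>2)) summable_on UNIV"
      using summable_mult2 [OF summable_exp_neg [OF b]]
      by (subst summable_on_UNIV_nonneg_real_iff) auto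
    ultimately show "(\<lambda>m. norm (\<Sum>\<^sub>\<infinity>f\<in>F. norm (case (m, f) of (m, f) \<Rightarrow> g m f))) summable_on UNIV"
      by (intro Infinite_Sum.abs_summable_on_comparison_test' [where g = "\<lambda>m. exp (- b * real m) * (L\<^sup>2 + K\<^sup>2)"])
        (auto simp: infsum_nonneg)
  qed
  from has_sum_infsum [OF abs_summable_summable [OF this]]
  obtain s where s: "((\<lambda>(m, f). g m f) has_sum s) (UNIV \<times> F)"
    by blast
  have "((\<lambda>m. w m * cinner (e m) (N (M (e m)))) has_sum s) UNIV"
  proof (rule has_sum_SigmaD [OF s])
    fix m
    show "((\<lambda>f. case (m, f) of (m, f) \<Rightarrow> g m f) has_sum w m * cinner (e m) (N (M (e m)))) F"
      using has_sum_cmult_right [OF onb_parseval [OF F, of "cadjoint N (e m)" "M (e m)"], of "w m"]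
      by (simp add: g_def cinner_cadjoint [OF N])
  qed
  then have "s = (\<Sum>n. w n * cinner (e n) (N (M (e n))))"
    using has_sum_imp_sums sums_unique by blast
  moreover have "((\<lambda>f. cinner f (M (gibbs b (N f)))) has_sum s) F"
  proof (rule has_sum_SigmaD)
    show "((\<lambda>(f, m). g m f) has_sum s) (F \<times> UNIV)"
      using s by (subst has_sum_swap) simp
    fix f
    \<comment> \<open>Applied to the series of \<open>gibbs b (N f)\<close>, this functional yields
      the terms \<open>g m f\<close>, because \<open>cinner (e m) (N f)\<close> equals
      \<open>cinner (cadjoint N (e m)) f\<close>.\<close>
    have "bounded_linear (\<lambda>y. cinner f (M y))"
      by (rule bounded_linear_compose [OF bounded_linear_cinner
            bounded_clinear_imp_bounded_linear [OF M]])
    from has_sum_bounded_linear [OF this gibbs_has_sum, of "N f"]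
    show "((\<lambda>m. case (f, m) of (f, m) \<Rightarrow> g m f) has_sum cinner f (M (gibbs b (N f)))) UNIV"
      by (simp add: g_def w_def bounded_clinear_scaleC [OF M] cinner_scaleC_right
          cinner_cadjoint [OF N] mult_ac)
  qed
  ultimately show ?thesis
    by (simp add: w_def)
qed

end

section \<open>Semigroup law and Hilbert-Schmidt factors\<close>

lemma gibbs_gibbs:
  assumes "b > 0" "c > 0"
  shows "gibbs b (gibbs c x) = gibbs (b + c) x"
proof (rule eqI_coeff)
  fix n
  have "- of_real (b + c) * of_nat n = - of_real b * of_nat n + - complex_of_real c * of_nat n"
    by (simp add: algebra_simps)
  then show "cinner (e n) (gibbs b (gibbs c x)) = cinner (e n) (gibbs (b + c) x)"
    using assms by (simp only: cinner_e_gibbs add_pos_pos exp_add mult.assoc)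
qed

text \<open>One basis suffices by definition, and on \<open>e\<close> the squared norms are at most
  a constant times \<open>exp (- (2 * b) * real n)\<close>.\<close>

lemma hilbert_schmidt_gibbs_right:
  fixes M :: "'a \<Rightarrow> 'a"
  assumes b: "b > 0" and M: "bounded_clinear M"
  shows "hilbert_schmidt (M \<circ> gibbs b)"
  unfolding hilbert_schmidt_def
proof (intro conjI exI)
  show "bounded_clinear (M \<circ> gibbs b)"
    by (intro bounded_clinear_comp M bounded_clinear_gibbs b)
  show "is_onb (range e)"
    by (rule onb_e)
  obtain K where K: "\<And>y. norm (M y) \<le> norm y * K"
    using bounded_linear.bounded [OF bounded_clinear_imp_bounded_linear [OF M]] by blast
  have "norm ((norm ((M \<circ> gibbs b) (e n)))\<^sup>2) \<le> exp (- (2 * b) * real n) * K\<^sup>2" for n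
  proof -
    have "norm ((M \<circ> gibbs b) (e n)) = exp (- b * real n) * norm (M (e n))"
      by (simp add: gibbs_e b bounded_clinear_scaleC [OF M] norm_scaleC norm_exp_eq_Re)
    moreover have "(exp (- b * real n))\<^sup>2 = exp (- (2 * b) * real n)"
      by (simp flip: exp_double)
    ultimately have "(norm ((M \<circ> gibbs b) (e n)))\<^sup>2 = exp (- (2 * b) * real n) * (norm (M (e n)))\<^sup>2"
      by (simp only: power_mult_distrib)
    then show ?thesis
      using K [of "e n"] by (simp add: power_mono)
  qed
  moreover have "summable (\<lambda>n. exp (- (2 * b) * real n) * K\<^sup>2)"
    using b by (intro summable_mult2 summable_exp_neg) simp
  ultimately have "summable (\<lambda>n. (norm ((M \<circ> gibbs b) (e n)))\<^sup>2)"
    by (rule summable_comparison_test' [rotated])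
  then have "(\<lambda>n. (norm ((M \<circ> gibbs b) (e n)))\<^sup>2) summable_on UNIV"
    by (simp add: summable_on_UNIV_nonneg_real_iff)
  then show "(\<lambda>f. (norm ((M \<circ> gibbs b) f))\<^sup>2) summable_on range e"
    by (simp only: summable_on_def has_sum_range_e)
qed

text \<open>\<open>N\<close> acts first and destroys the diagonal form. The squared norms are
  instead the diagonal entries of \<open>cadjoint N\<close>, \<open>gibbs (b + b)\<close>,
  \<open>N\<close> in product, which \<open>gibbs_trace_cyclic\<close> sums.\<close>

lemma hilbert_schmidt_gibbs_left:
  fixes N :: "'a \<Rightarrow> 'a"
  assumes b: "b > 0" and N: "bounded_clinear N"
  shows "hilbert_schmidt (gibbs b \<circ> N)"
  unfolding hilbert_schmidt_def
proof (intro conjI exI)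
  show "bounded_clinear (gibbs b \<circ> N)"
    by (intro bounded_clinear_comp N bounded_clinear_gibbs b)
  show "is_onb (range e)"
    by (rule onb_e)
  have "cinner f (cadjoint N (gibbs (b + b) (N f))) = complex_of_real ((norm ((gibbs b \<circ> N) f))\<^sup>2)"
    for f
    unfolding cinner_cadjoint_right [OF N] gibbs_gibbs [OF b b, symmetric]
      cinner_gibbs_commute [OF b, symmetric] o_def cinner_self ..
  then have "(\<lambda>f. complex_of_real ((norm ((gibbs b \<circ> N) f))\<^sup>2)) summable_on range e"
    using gibbs_trace_cyclic [OF _ bounded_clinear_cadjoint [OF N] N onb_e, of "b + b"] b
    by (auto simp: summable_on_def simp del: of_real_power)
  from summable_on_bounded_linear [OF bounded_linear_Re this]
  show "(\<lambda>f. (norm ((gibbs b \<circ> N) f))\<^sup>2) summable_on range e"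
    by (simp only: Re_complex_of_real)
qed

end

text \<open>\<open>tr\<close> quantifies over all bases, so without any basis every value would
  qualify; \<open>G\<close> secures uniqueness.\<close>

lemma tr_eqI:
  fixes G :: "'a::complex_hilbert_space set" and X :: "'a operator"
  assumes "is_onb G" and "\<And>F. is_onb F \<Longrightarrow> ((\<lambda>f. cinner f (the (X f))) has_sum t) F"
  shows "tr X = t"
  unfolding tr_def
proof (rule the_equality)
  fix u
  assume "\<forall>F. is_onb F \<longrightarrow> ((\<lambda>f. cinner f (the (X f))) has_sum u) F"
  then have "((\<lambda>f. cinner f (the (X f))) has_sum u) G"
    using assms(1) by blast
  then show "u = t"
    using assms(2) [OF assms(1)] has_sum_unique by metis
qed (use assms(2) in blast)

section \<open>The two values of the functional and the trace compared\<close>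

theorem mainTheorem6:
  fixes e \<phi> \<psi> :: "nat \<Rightarrow> 'a::complex_hilbert_space"
    and H0 :: "'a operator"
    and T A B :: "'a \<Rightarrow> 'a"
    and \<beta> :: real
  assumes e_inj: "inj e"
    and e_onb: "is_onb (range e)"
    and H0_self_adjoint: "self_adjoint H0"
    and H0_e: "\<And>n. H0 (e n) = Some (of_nat n *\<^sub>C e n)"
    and T_bounded: "bounded_clinear T"
    and T_bij: "bij T"
    and T_inv_bounded: "bounded_clinear (inv T)"
    and phi: "\<And>n. \<phi> n = T (e n)"
    and psi: "\<And>n. \<psi> n = inv (cadjoint T) (e n)"
    and beta: "\<beta> > 0"
    and A_bounded: "bounded_clinear A"
    and B_bounded: "bounded_clinear B"
  shows "omega_defined \<beta> \<phi> \<psi> (bop (B \<circ> A)) \<and>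
    omega_defined \<beta> \<phi> \<psi> (bop A \<circ>\<^sub>m alpha_psi H0 T (\<i> * of_real \<beta>) (bop B)) \<and>
    trace_class (exp_Hstar (- of_real \<beta>) H0 T \<circ>\<^sub>m bop (B \<circ> A)) \<and>
    omega \<beta> \<phi> \<psi> (bop (B \<circ> A)) =
      omega \<beta> \<phi> \<psi> (bop A \<circ>\<^sub>m alpha_psi H0 T (\<i> * of_real \<beta>) (bop B)) \<and>
    omega \<beta> \<phi> \<psi> (bop (B \<circ> A)) =
      1 / of_real (Z0 \<beta>) * tr (exp_Hstar (- of_real \<beta>) H0 T \<circ>\<^sub>m bop (B \<circ> A))"
proof -
  interpret number_operator e H0
    by unfold_locales (use e_inj e_onb H0_self_adjoint H0_e in auto)
  define S where "S = cadjoint T"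
  define R where "R = inv S"
  have S: "bounded_clinear S" and R: "bounded_clinear R"
    using T_bounded T_bij T_inv_bounded
    by (simp_all add: S_def R_def inv_cadjoint bounded_clinear_cadjoint)
  have bij_S: "bij S"
    using T_bounded T_bij T_inv_bounded by (simp add: S_def inv_cadjoint)
  have RS [simp]: "R (S x) = x" for x
    using bij_S by (simp add: R_def bij_is_inj)
  have SR [simp]: "S (R x) = x" for x
    using bij_S by (simp add: R_def bij_is_surj surj_f_inv_f)
  have cinner_phi: "cinner (\<phi> n) x = cinner (e n) (S x)" for n x
    by (simp add: phi S_def cinner_cadjoint_right T_bounded)
  have psi_R: "\<psi> n = R (e n)" for n
    by (simp add: psi R_def S_def)
  define X1 where "X1 = (bop (B \<circ> A) :: 'a operator)"
  define X2 where "X2 = bop A \<circ>\<^sub>m alpha_psi H0 T (\<i> * of_real \<beta>) (bop B)"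
  define X3 where "X3 = exp_Hstar (- of_real \<beta>) H0 T \<circ>\<^sub>m bop (B \<circ> A)"
  define w where "w n = exp (- complex_of_real \<beta> * of_nat n)" for n
  \<comment> \<open>The common value: both functionals equal \<open>t / Z0\<close> and the trace
    equals \<open>t\<close>.\<close>
  define t where "t = (\<Sum>n. w n * cinner (e n) ((S \<circ> B \<circ> A \<circ> R) (e n)))"
  note bounded = bounded_clinear_comp S R A_bounded B_bounded

  have w: "complex_of_real (exp (- \<beta> * real n)) = w n" for n
    by (simp add: w_def flip: exp_of_real)
  have term1: "omega_term \<beta> \<phi> \<psi> X1 = (\<lambda>n. w n * cinner (e n) ((S \<circ> B \<circ> A \<circ> R) (e n)))"
    unfolding omega_term_def w cinner_phi by (simp add: X1_def psi_R)
  have sum1: "summable (\<lambda>n. norm (omega_term \<beta> \<phi> \<psi> X1 n))"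
    unfolding term1 w_def by (intro summable_gibbs_diagonal beta bounded)

  have X2_psi: "X2 (\<psi> n) = Some (A (R (gibbs \<beta> (S (B (R (exp (of_real \<beta> * of_nat n) *\<^sub>C e n)))))))"
    for n
  proof -
    \<comment> \<open>At imaginary time the left exponential in \<open>alpha0\<close> decays and is
      total, while the right one grows. It is applied only to \<open>S (\<psi> n) = e n\<close>,
      which lies in its domain.\<close>
    have t: "\<i> * (\<i> * complex_of_real \<beta>) = - of_real \<beta>"
        "- \<i> * (\<i> * complex_of_real \<beta>) = of_real \<beta>"
      by (simp_all flip: mult.assoc)
    show ?thesis
      unfolding X2_def alpha_psi_def alpha0_def t S_def [symmetric] R_def [symmetric] psi_R
      by (simp add: map_comp_def exp_operator_e exp_operator_gibbs beta)
  qed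
  have term2: "omega_term \<beta> \<phi> \<psi> X2 = (\<lambda>n. cinner (e n) ((S \<circ> A \<circ> R) (gibbs \<beta> ((S \<circ> B \<circ> R) (e n)))))"
  proof
    fix n
    \<comment> \<open>The growth factor is a scalar, so it passes through all the complex linear
      maps and meets the Gibbs weight.\<close>
    have "w n * exp (of_real \<beta> * of_nat n) = 1"
      by (simp add: w_def flip: exp_add)
    then show "omega_term \<beta> \<phi> \<psi> X2 n = cinner (e n) ((S \<circ> A \<circ> R) (gibbs \<beta> ((S \<circ> B \<circ> R) (e n))))"
      unfolding omega_term_def w cinner_phi X2_psi
      by (simp add: bounded_clinear_scaleC [OF A_bounded] bounded_clinear_scaleC [OF B_bounded]
          bounded_clinear_scaleC [OF S] bounded_clinear_scaleC [OF R]
          bounded_clinear_scaleC [OF bounded_clinear_gibbs [OF beta]]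
          cinner_scaleC_right flip: mult.assoc)
  qed
  have has_sum2: "(omega_term \<beta> \<phi> \<psi> X2 has_sum t) UNIV"
  proof -
    \<comment> \<open>With these as \<open>M\<close> and \<open>N\<close>, the inner
      \<open>R\<close> and \<open>S\<close> cancel in \<open>N (M (e n))\<close>, which leaves the
      summands of \<open>t\<close>.\<close>
    have "bounded_clinear (S \<circ> A \<circ> R)" "bounded_clinear (S \<circ> B \<circ> R)"
      by (intro bounded)+
    from gibbs_trace_cyclic [OF beta this onb_e] show ?thesis
      unfolding term2 has_sum_range_e by (simp add: t_def w_def)
  qed
  \<comment> \<open>For complex families unconditional summability is already absolute.\<close>
  then have "(\<lambda>n. norm (omega_term \<beta> \<phi> \<psi> X2 n)) summable_on UNIV"
    using has_sum_imp_summable summable_on_iff_abs_summable_on_complex by metis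
  then have sum2: "summable (\<lambda>n. norm (omega_term \<beta> \<phi> \<psi> X2 n))"
    by (simp add: summable_on_UNIV_nonneg_real_iff)

  have X3: "X3 = bop (\<lambda>x. R (gibbs \<beta> (S (B (A x)))))"
    by (auto simp: X3_def exp_Hstar_def map_comp_def exp_operator_gibbs beta S_def R_def)
  \<comment> \<open>Half of the Gibbs operator goes to each side, so that both factors are
    Hilbert-Schmidt.\<close>
  have "X3 = bop ((R \<circ> gibbs (\<beta> / 2)) \<circ> (gibbs (\<beta> / 2) \<circ> (S \<circ> B \<circ> A)))"
    using beta by (simp add: X3 gibbs_gibbs)
  moreover have "hilbert_schmidt (R \<circ> gibbs (\<beta> / 2))" "hilbert_schmidt (gibbs (\<beta> / 2) \<circ> (S \<circ> B \<circ> A))"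
    using beta by (simp_all add: hilbert_schmidt_gibbs_left hilbert_schmidt_gibbs_right bounded)
  ultimately have "trace_class X3"
    unfolding trace_class_def by blast
  moreover have "tr X3 = t"
  proof (rule tr_eqI [OF e_onb])
    show "((\<lambda>f. cinner f (the (X3 f))) has_sum t) F" if "is_onb F" for F
      \<comment> \<open>Here \<open>M\<close> is \<open>R\<close> and \<open>N\<close> is
        \<open>S \<circ> B \<circ> A\<close>; their product in reverse order again gives the
        summands of \<open>t\<close>, for every \<open>F\<close>.\<close>
      using gibbs_trace_cyclic [OF beta R _ that, of "S \<circ> B \<circ> A"]
      by (simp add: bounded t_def w_def X3)
  qed
  moreover have "omega \<beta> \<phi> \<psi> X1 = 1 / of_real (Z0 \<beta>) * t"
    by (simp add: omega_def term1 t_def)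
  moreover have "omega \<beta> \<phi> \<psi> X2 = 1 / of_real (Z0 \<beta>) * t"
    using has_sum_imp_sums [OF has_sum2] by (simp add: omega_def sums_iff)
  moreover have "omega_defined \<beta> \<phi> \<psi> X1"
    using sum1 by (auto simp: omega_defined_def X1_def)
  moreover have "omega_defined \<beta> \<phi> \<psi> X2"
    using sum2 X2_psi by (auto simp: omega_defined_def)
  ultimately show ?thesis
    unfolding X1_def X2_def X3_def by simp
qed

end
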